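(* Let $\{p(\tau)\}_{\tau\in\mathbb{N}_0}$ be a probability distribution on $\mathbb{N}_0$ and let $\{(X,T)_t\}_{t\ge 0}$ be the trapped random walk with trapping time distribution $p$, started at the origin, i.e. $\mathbb{P}((X,T)_0=(z,\tau))=p(\tau)$ if $z=0$ and $=0$ otherwise. Let $\sigma_t^2:=\mathbb{E}(X_t^2)$. Then for each $t\in\mathbb{N}$, $$\sigma_{t+1}^2=\sum_{0\leq\tau\leq t}p(\tau)\left(\sigma^2_{t-\tau}+1\right).$$
   Context: $\mathbb{N}_0=\{0,1,2,\dots\}$. Trapped random walk with trapping time distribution $p$: the discrete-time Markov chain $(X,T)_t=(X_t,T_t)$ on $\mathbb{Z}\times\mathbb{N}_0$ with transition probabilities $$\mathbb{P}((X,T)_{t+1}=(z',\tau')\mid (X,T)_t=(z,\tau))=\begin{cases}p(\tau')/2 & \text{if } |z-z'|=1 \text{ and } \tau=0,\\ 1 & \text{if } z=z' \text{ and } \tau'=\tau-1\geq 0,\\ 0&\text{otherwise.}\end{cases}$$ $X_t$ is the position and $T_t$ the remaining trapping time. The quantity $\sigma_t^2=\mathbb{E}(X_t^2)=\sum_{z\in\mathbb{Z}}z^2\,\mathbb{P}(X_t=z)$ is the mean squared displacement; $\sigma_0^2=0$. *)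

theory Defs
  imports "HOL-Probability.Probability"
begin

(* A time-homogeneous discrete-time Markov chain on a countable state space, with one-step
   transition probabilities K. As usual, the Markov property is only imposed on conditional
   probabilities given histories of positive probability. *)
definition markov_chain ::
  "'a measure \<Rightarrow> ('s::countable \<Rightarrow> 's \<Rightarrow> real) \<Rightarrow> (nat \<Rightarrow> 'a \<Rightarrow> 's) \<Rightarrow> bool" where
  "markov_chain M K Y \<longleftrightarrow>
     prob_space M \<and>
     (\<forall>t. Y t \<in> measurable M (count_space UNIV)) \<and>
     (\<forall>t y s'. \<P>(\<omega> in M. \<forall>i\<le>t. Y i \<omega> = y i) > 0 \<longrightarrow>
        \<P>(\<omega> in M. Y (t + 1) \<omega> = s' \<bar> \<forall>i\<le>t. Y i \<omega> = y i) = K (y t) s')"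

(* The condition tau' = tau - 1 >= 0 is written additively, avoiding truncated subtraction. *)
fun trw_kernel :: "nat pmf \<Rightarrow> int \<times> nat \<Rightarrow> int \<times> nat \<Rightarrow> real" where
  "trw_kernel p (z, \<tau>) (z', \<tau>') =
     (if \<bar>z - z'\<bar> = 1 \<and> \<tau> = 0 then pmf p \<tau>' / 2
      else if z = z' \<and> \<tau> = \<tau>' + 1 then 1
      else 0)"

definition trapped_random_walk ::
  "'a measure \<Rightarrow> nat pmf \<Rightarrow> (nat \<Rightarrow> 'a \<Rightarrow> int) \<Rightarrow> (nat \<Rightarrow> 'a \<Rightarrow> nat) \<Rightarrow> bool" where
  "trapped_random_walk M p X T \<longleftrightarrow>
     markov_chain M (trw_kernel p) (\<lambda>t \<omega>. (X t \<omega>, T t \<omega>))"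

definition started_at_origin ::
  "'a measure \<Rightarrow> nat pmf \<Rightarrow> (nat \<Rightarrow> 'a \<Rightarrow> int) \<Rightarrow> (nat \<Rightarrow> 'a \<Rightarrow> nat) \<Rightarrow> bool" where
  "started_at_origin M p X T \<longleftrightarrow>
     (\<forall>z \<tau>. \<P>(\<omega> in M. (X 0 \<omega>, T 0 \<omega>) = (z, \<tau>)) = (if z = 0 then pmf p \<tau> else 0))"

(* The Bochner integral is a genuine expectation for a walk started at the origin, since then
   the absolute value of X t is almost surely at most t. *)
definition msd :: "'a measure \<Rightarrow> (nat \<Rightarrow> 'a \<Rightarrow> int) \<Rightarrow> nat \<Rightarrow> real" where
  "msd M X t = (\<integral>\<omega>. (real_of_int (X t \<omega>))\<^sup>2 \<partial>M)"

end

theory Submission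
  imports Defs
begin

text \<open>
  Put \<open>u t = \<P>(T t = 0)\<close>. A jump is symmetric with unit length and happens at time \<open>t\<close> exactly when
  \<open>T t = 0\<close>, so the mean squared displacement at time \<open>t\<close> is \<open>\<Sum>s<t. u s\<close>. On the other hand \<open>T\<close> is
  itself a Markov chain, whose law satisfies
  \<open>\<P>(T (t + 1) = k) = \<P>(T t = k + 1) + u t * p k\<close>; unrolling this yields the
  renewal equation \<open>u t = p t + (\<Sum>s<t. u s * p (t - 1 - s))\<close>, and summing it over \<open>t\<close> gives the claim.
\<close>

section \<open>One-step evolution of the law of a Markov chain\<close>

text \<open>The Markov property speaks only about full histories of positive probability.
  Partitioning the space by the history up to time \<open>t\<close> and summing the resulting
  identities removes the history and leaves the one-step equation.\<close>

lemma markov_chain_emeasure_Suc: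
  fixes Y :: "nat \<Rightarrow> 'a \<Rightarrow> 's::countable"
  assumes "markov_chain M K Y"
  shows "emeasure M {\<omega>\<in>space M. Y (Suc t) \<omega> = s} = (\<integral>\<^sup>+\<omega>. ennreal (K (Y t \<omega>) s) \<partial>M)"
proof -
  interpret prob_space M
    using assms by (simp add: markov_chain_def)
  have [measurable]: "Y i \<in> measurable M (count_space UNIV)" for i
    using assms by (simp add: markov_chain_def)
  have step: "\<P>(\<omega> in M. Y (Suc t) \<omega> = s' \<bar> \<forall>i\<le>t. Y i \<omega> = y i) = K (y t) s'"
    if "\<P>(\<omega> in M. \<forall>i\<le>t. Y i \<omega> = y i) > 0" for y s'
    using assms that by (simp add: markov_chain_def)
  \<comment> \<open>Recording the history as a list keeps the index set countable, so the integral
    can be exchanged with the sum over all histories.\<close>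
  define h where "h \<omega> = map (\<lambda>i. Y i \<omega>) [0..<Suc t]" for \<omega>
  have h_eq: "h \<omega> = l \<longleftrightarrow> length l = Suc t \<and> (\<forall>i\<le>t. Y i \<omega> = l ! i)" for \<omega> l
    unfolding h_def list_eq_iff_nth_eq by (auto simp: less_Suc_eq_le simp del: upt_Suc)
  have [measurable]: "Measurable.pred M (\<lambda>\<omega>. h \<omega> = l)" for l
    unfolding h_eq by measurable
  have split: "(\<integral>\<^sup>+\<omega>. f \<omega> \<partial>M) =
      (\<integral>\<^sup>+l. (\<integral>\<^sup>+\<omega>. f \<omega> * indicator {\<omega>. h \<omega> = l} \<omega> \<partial>M) \<partial>count_space UNIV)"
    if [measurable]: "f \<in> borel_measurable M" for f
  proof -
    have "(\<integral>\<^sup>+l. f \<omega> * indicator {\<omega>. h \<omega> = l} \<omega> \<partial>count_space UNIV) = f \<omega>" for \<omega>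
    proof -
      have "(\<integral>\<^sup>+l. f \<omega> * indicator {\<omega>. h \<omega> = l} \<omega> \<partial>count_space UNIV)
          = (\<integral>\<^sup>+l. f \<omega> * indicator {h \<omega>} l \<partial>count_space UNIV)"
        by (intro nn_integral_cong) (auto split: split_indicator)
      then show ?thesis
        by (simp add: nn_integral_cmult_indicator)
    qed
    then have "(\<integral>\<^sup>+\<omega>. f \<omega> \<partial>M) =
        (\<integral>\<^sup>+\<omega>. (\<integral>\<^sup>+l. f \<omega> * indicator {\<omega>. h \<omega> = l} \<omega> \<partial>count_space UNIV) \<partial>M)"
      by simp
    also have "\<dots> = (\<integral>\<^sup>+l. (\<integral>\<^sup>+\<omega>. f \<omega> * indicator {\<omega>. h \<omega> = l} \<omega> \<partial>M) \<partial>count_space UNIV)"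
      by (rule nn_integral_count_space_nn_integral) auto
    finally show ?thesis .
  qed
  have "emeasure M {\<omega>\<in>space M. Y (Suc t) \<omega> = s}
      = (\<integral>\<^sup>+\<omega>. indicator {\<omega>\<in>space M. Y (Suc t) \<omega> = s} \<omega> \<partial>M)"
    by simp
  also have "\<dots> = (\<integral>\<^sup>+l. (\<integral>\<^sup>+\<omega>. indicator {\<omega>\<in>space M. Y (Suc t) \<omega> = s} \<omega> *
      indicator {\<omega>. h \<omega> = l} \<omega> \<partial>M) \<partial>count_space UNIV)"
    by (rule split) simp
  also have "\<dots> = (\<integral>\<^sup>+l. (\<integral>\<^sup>+\<omega>. ennreal (K (Y t \<omega>) s) * indicator {\<omega>. h \<omega> = l} \<omega> \<partial>M) \<partial>count_space UNIV)"
  proof (rule nn_integral_cong)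
    fix l
    let ?A = "{\<omega>\<in>space M. h \<omega> = l}"
    have "(\<integral>\<^sup>+\<omega>. indicator {\<omega>\<in>space M. Y (Suc t) \<omega> = s} \<omega> * indicator {\<omega>. h \<omega> = l} \<omega> \<partial>M)
        = (\<integral>\<^sup>+\<omega>. indicator {\<omega>\<in>space M. Y (Suc t) \<omega> = s \<and> h \<omega> = l} \<omega> \<partial>M)"
      by (intro nn_integral_cong) (auto split: split_indicator)
    also have "\<dots> = emeasure M {\<omega>\<in>space M. Y (Suc t) \<omega> = s \<and> h \<omega> = l}"
      by simp
    also have "\<dots> = ennreal (K (l ! t) s) * emeasure M ?A"
    proof (cases "measure M ?A = 0")
      \<comment> \<open>On a null history \<open>K\<close> is unconstrained, but both sides
        vanish.\<close>
      case True
      have "measure M {\<omega>\<in>space M. Y (Suc t) \<omega> = s \<and> h \<omega> = l} \<le> measure M ?A"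
        by (intro finite_measure_mono) auto
      then have "measure M {\<omega>\<in>space M. Y (Suc t) \<omega> = s \<and> h \<omega> = l} = 0"
        using True by (simp add: measure_le_0_iff)
      then show ?thesis
        using True by (simp add: emeasure_eq_measure)
    next
      case False
      then have "?A \<noteq> {}"
        by force
      then have len: "length l = Suc t"
        by (auto simp: h_eq)
      have pos: "measure M ?A > 0"
        using False by (simp add: zero_less_measure_iff)
      have A: "?A = {\<omega>\<in>space M. \<forall>i\<le>t. Y i \<omega> = l ! i}"
        using len by (auto simp: h_eq)
      have "K (l ! t) s = \<P>(\<omega> in M. Y (Suc t) \<omega> = s \<bar> \<forall>i\<le>t. Y i \<omega> = l ! i)"
        using step[of "\<lambda>i. l ! i" s] pos A by simp
      also have "\<dots> = measure M {\<omega>\<in>space M. Y (Suc t) \<omega> = s \<and> h \<omega> = l} / measure M ?A"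
        using len by (simp add: cond_prob_def h_eq)
      finally have K: "K (l ! t) s
          = measure M {\<omega>\<in>space M. Y (Suc t) \<omega> = s \<and> h \<omega> = l} / measure M ?A" .
      \<comment> \<open>\<open>K\<close> is an arbitrary real function, and \<open>ennreal\<close>
        sends negative numbers to 0. Nonnegativity at this entry comes from its being a conditional
        probability.\<close>
      then have "K (l ! t) s \<ge> 0" by simp
      then show ?thesis
        using K pos by (simp add: emeasure_eq_measure flip: ennreal_mult)
    qed
    also have "\<dots> = (\<integral>\<^sup>+\<omega>. ennreal (K (l ! t) s) * indicator ?A \<omega> \<partial>M)"
      by (simp add: nn_integral_cmult_indicator)
    also have "\<dots> = (\<integral>\<^sup>+\<omega>. ennreal (K (Y t \<omega>) s) * indicator {\<omega>. h \<omega> = l} \<omega> \<partial>M)"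
      by (intro nn_integral_cong) (auto simp: h_eq split: split_indicator)
    finally show "(\<integral>\<^sup>+\<omega>. indicator {\<omega>\<in>space M. Y (Suc t) \<omega> = s} \<omega> * indicator {\<omega>. h \<omega> = l} \<omega> \<partial>M)
        = (\<integral>\<^sup>+\<omega>. ennreal (K (Y t \<omega>) s) * indicator {\<omega>. h \<omega> = l} \<omega> \<partial>M)" .
  qed
  also have "\<dots> = (\<integral>\<^sup>+\<omega>. ennreal (K (Y t \<omega>) s) \<partial>M)"
    by (rule split[symmetric]) measurable
  finally show ?thesis .
qed

lemma markov_chain_distr_Suc:
  fixes Y :: "nat \<Rightarrow> 'a \<Rightarrow> 's::countable"
  assumes mc: "markov_chain M (\<lambda>s. pmf (k s)) Y"
    and law: "distr M (count_space UNIV) (Y t) = measure_pmf \<mu>"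
  shows "distr M (count_space UNIV) (Y (Suc t)) = measure_pmf (bind_pmf \<mu> k)"
proof (rule measure_eqI_countable[where A = UNIV])
  fix s
  have [measurable]: "Y i \<in> measurable M (count_space UNIV)" for i
    using mc by (simp add: markov_chain_def)
  have "emeasure (distr M (count_space UNIV) (Y (Suc t))) {s}
      = emeasure M {\<omega>\<in>space M. Y (Suc t) \<omega> = s}"
    by (subst emeasure_distr) (auto intro!: arg_cong2[where f = emeasure])
  also have "\<dots> = (\<integral>\<^sup>+\<omega>. ennreal (pmf (k (Y t \<omega>)) s) \<partial>M)"
    by (rule markov_chain_emeasure_Suc[OF mc])
  also have "\<dots> = (\<integral>\<^sup>+x. ennreal (pmf (k x) s) \<partial>distr M (count_space UNIV) (Y t))"
    by (subst nn_integral_distr) auto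
  also have "\<dots> = ennreal (pmf (bind_pmf \<mu> k) s)"
    by (simp add: law ennreal_pmf_bind)
  finally show "emeasure (distr M (count_space UNIV) (Y (Suc t))) {s}
      = emeasure (measure_pmf (bind_pmf \<mu> k)) {s}"
    by (simp add: emeasure_pmf_single)
qed auto

section \<open>The law of the trapped random walk\<close>

text \<open>Packaging each row of the kernel as a \<open>pmf\<close> turns the law of the walk into
  an iterated \<open>bind_pmf\<close>, independent of the space \<open>M\<close>.\<close>

fun trw_step :: "nat pmf \<Rightarrow> int \<times> nat \<Rightarrow> (int \<times> nat) pmf" where
  "trw_step p (z, 0) = pair_pmf (pmf_of_set {z - 1, z + 1}) p"
| "trw_step p (z, Suc \<tau>) = return_pmf (z, \<tau>)"

lemma trw_kernel_eq: "trw_kernel p = (\<lambda>s. pmf (trw_step p s))"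
proof (intro ext)
  fix s s' :: "int \<times> nat"
  obtain z \<tau> z' \<tau>' where "s = (z, \<tau>)" "s' = (z', \<tau>')"
    by (metis surj_pair)
  then show "trw_kernel p s s' = pmf (trw_step p s) s'"
    by (cases \<tau>) (auto simp: pmf_pair indicator_def)
qed

primrec trw_law :: "nat pmf \<Rightarrow> nat \<Rightarrow> (int \<times> nat) pmf" where
  "trw_law p 0 = map_pmf (Pair 0) p"
| "trw_law p (Suc t) = bind_pmf (trw_law p t) (trw_step p)"

lemma distr_trapped_random_walk:
  assumes "trapped_random_walk M p X T" and "started_at_origin M p X T"
  shows "distr M (count_space UNIV) (\<lambda>\<omega>. (X t \<omega>, T t \<omega>)) = measure_pmf (trw_law p t)"
proof (induction t)
  case 0
  have mc: "markov_chain M (trw_kernel p) (\<lambda>t \<omega>. (X t \<omega>, T t \<omega>))"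
    using assms(1) by (simp add: trapped_random_walk_def)
  interpret prob_space M
    using mc by (simp add: markov_chain_def)
  have [measurable]: "(\<lambda>\<omega>. (X 0 \<omega>, T 0 \<omega>)) \<in> measurable M (count_space UNIV)"
    using mc by (simp add: markov_chain_def)
  show ?case
  proof (rule measure_eqI_countable[where A = UNIV])
    fix s :: "int \<times> nat"
    obtain z \<tau> where s: "s = (z, \<tau>)" by force
    have "emeasure (distr M (count_space UNIV) (\<lambda>\<omega>. (X 0 \<omega>, T 0 \<omega>))) {s}
        = emeasure M {\<omega>\<in>space M. (X 0 \<omega>, T 0 \<omega>) = (z, \<tau>)}"
      by (subst emeasure_distr) (auto simp: s intro!: arg_cong2[where f = emeasure])
    also have "\<dots> = ennreal (if z = 0 then pmf p \<tau> else 0)"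
      using assms(2) by (simp add: started_at_origin_def emeasure_eq_measure)
    also have "(if z = 0 then pmf p \<tau> else 0) = pmf (map_pmf (Pair 0) p) s"
      unfolding s by (auto simp: pmf_map_inj' inj_on_def pmf_eq_0_set_pmf)
    finally show "emeasure (distr M (count_space UNIV) (\<lambda>\<omega>. (X 0 \<omega>, T 0 \<omega>))) {s}
        = emeasure (measure_pmf (trw_law p 0)) {s}"
      by (simp add: emeasure_pmf_single)
  qed auto
next
  case (Suc t)
  then show ?case
    using assms(1) markov_chain_distr_Suc[of M "trw_step p" "\<lambda>t \<omega>. (X t \<omega>, T t \<omega>)" t "trw_law p t"]
    by (simp add: trapped_random_walk_def trw_kernel_eq)
qed

section \<open>Trapping times and mean squared displacement\<close>

abbreviation trap_law :: "nat pmf \<Rightarrow> nat \<Rightarrow> nat pmf" where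
  "trap_law p t \<equiv> map_pmf snd (trw_law p t)"

text \<open>The value \<open>k\<close> arises either by counting down from \<open>Suc k\<close> or,
  when the trap has expired, as a fresh draw from \<open>p\<close>.\<close>

lemma trap_law_Suc:
  "pmf (trap_law p (Suc t)) k = pmf (trap_law p t) (Suc k) + pmf (trap_law p t) 0 * pmf p k"
proof -
  \<comment> \<open>The next trapping time depends on the state only through its second component,
    so the position can be projected away.\<close>
  have step: "map_pmf snd (trw_step p s) = (case snd s of 0 \<Rightarrow> p | Suc \<tau> \<Rightarrow> return_pmf \<tau>)" for s
    by (cases "(p, s)" rule: trw_step.cases) (auto simp: map_snd_pair_pmf)
  have int: "(\<integral>\<tau>. indicator {Suc k} \<tau> + indicator {0} \<tau> * pmf p k \<partial>N) = pmf N (Suc k) + pmf N 0 * pmf p k"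
    for N :: "nat pmf"
    by (subst Bochner_Integration.integral_add)
      (auto simp: measure_pmf_single measure_pmf.emeasure_eq_measure)
  have "trap_law p (Suc t) = bind_pmf (trap_law p t) (case_nat p return_pmf)"
    by (simp add: map_bind_pmf bind_map_pmf step)
  then have "pmf (trap_law p (Suc t)) k
      = (\<integral>\<tau>. pmf (case_nat p return_pmf \<tau>) k \<partial>trap_law p t)"
    by (simp only: pmf_bind)
  also have "\<dots> = (\<integral>\<tau>. indicator {Suc k} \<tau> + indicator {0} \<tau> * pmf p k \<partial>trap_law p t)"
    by (intro Bochner_Integration.integral_cong) (auto split: nat.split split_indicator)
  also have "\<dots> = pmf (trap_law p t) (Suc k) + pmf (trap_law p t) 0 * pmf p k"
    by (rule int)
  finally show ?thesis .
qed

text \<open>Decomposition by the latest draw: either the initial one, which has counted down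
  \<open>t\<close> steps, or the one made on jumping from time \<open>s\<close> to
  \<open>Suc s\<close>, which has counted down \<open>t - Suc s\<close> steps.\<close>

lemma trap_law_eq:
  "pmf (trap_law p t) k
    = pmf p (t + k) + (\<Sum>s<t. pmf (trap_law p s) 0 * pmf p (t - Suc s + k))"
proof (induction t arbitrary: k)
  case 0
  show ?case by (simp add: map_pmf_comp)
next
  case (Suc t)
  \<comment> \<open>Since \<open>s < t\<close>, no subtraction truncates here. The missing summand
    \<open>s = t\<close> is the fresh draw in \<open>trap_law_Suc\<close>.\<close>
  have "(\<Sum>s<t. pmf (trap_law p s) 0 * pmf p (t - Suc s + Suc k))
      = (\<Sum>s<t. pmf (trap_law p s) 0 * pmf p (Suc t - Suc s + k))"
    by (intro sum.cong) (auto simp: Suc_diff_Suc)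
  then show ?case
    unfolding trap_law_Suc Suc.IH[of "Suc k"] by simp
qed

text \<open>The average of (z - 1)^2 and (z + 1)^2 is z^2 + 1, and a trapped walker does not
  move.\<close>

lemma nn_integral_trw_step_square:
  "(\<integral>\<^sup>+s'. ennreal ((real_of_int (fst s'))\<^sup>2) \<partial>trw_step p s)
    = ennreal ((real_of_int (fst s))\<^sup>2) + indicator {0} (snd s)"
proof (cases "(p, s)" rule: trw_step.cases)
  case (1 q z)
  then have s: "s = (z, 0)" by simp
  have "(\<integral>\<^sup>+s'. ennreal ((real_of_int (fst s'))\<^sup>2) \<partial>trw_step p s)
      = (\<integral>\<^sup>+y. ennreal ((real_of_int y)\<^sup>2) \<partial>map_pmf fst (trw_step p s))"
    by simp
  also have "\<dots> = (\<integral>\<^sup>+y. ennreal ((real_of_int y)\<^sup>2) \<partial>pmf_of_set {z - 1, z + 1})"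
    by (simp only: s trw_step.simps map_fst_pair_pmf)
  also have "\<dots> = ennreal ((real_of_int z)\<^sup>2 + 1)"
    by (simp add: nn_integral_pmf_of_set divide_ennreal flip: ennreal_plus ennreal_numeral)
      (simp add: power2_eq_square algebra_simps)
  finally show ?thesis by (simp add: s)
next
  case (2 q z \<tau>)
  then show ?thesis by simp
qed

text \<open>With nonnegative integrals, finiteness of the second moment comes out of the induction
  instead of being a prerequisite.\<close>

lemma nn_integral_trw_law_square:
  "(\<integral>\<^sup>+s. ennreal ((real_of_int (fst s))\<^sup>2) \<partial>trw_law p t)
    = ennreal (\<Sum>s<t. pmf (trap_law p s) 0)"
proof (induction t)
  case (Suc t)
  have "(\<integral>\<^sup>+s. ennreal ((real_of_int (fst s))\<^sup>2) \<partial>trw_law p (Suc t))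
      = (\<integral>\<^sup>+s. ennreal ((real_of_int (fst s))\<^sup>2) + indicator {0} (snd s) \<partial>trw_law p t)"
    by (simp only: trw_law.simps nn_integral_bind_pmf nn_integral_trw_step_square)
  also have "\<dots> = (\<integral>\<^sup>+s. ennreal ((real_of_int (fst s))\<^sup>2) \<partial>trw_law p t)
      + (\<integral>\<^sup>+\<tau>. indicator {0} \<tau> \<partial>trap_law p t)"
    by (simp add: nn_integral_add)
  also have "\<dots> = ennreal (\<Sum>s<Suc t. pmf (trap_law p s) 0)"
    unfolding Suc.IH
    by (subst nn_integral_indicator)
      (simp_all add: emeasure_pmf_single sum_nonneg flip: ennreal_plus del: pmf_map)
  finally show ?case .
qed simp

lemma msd_eq:
  assumes "trapped_random_walk M p X T" and "started_at_origin M p X T"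
  shows "msd M X t = (\<Sum>s<t. pmf (trap_law p s) 0)"
proof -
  have [measurable]: "(\<lambda>\<omega>. (X t \<omega>, T t \<omega>)) \<in> measurable M (count_space UNIV)"
    using assms(1) by (simp add: trapped_random_walk_def markov_chain_def)
  have "msd M X t = (\<integral>s. (real_of_int (fst s))\<^sup>2 \<partial>distr M (count_space UNIV) (\<lambda>\<omega>. (X t \<omega>, T t \<omega>)))"
    unfolding msd_def by (subst integral_distr) auto
  also have "\<dots> = (\<integral>s. (real_of_int (fst s))\<^sup>2 \<partial>trw_law p t)"
    by (simp only: distr_trapped_random_walk[OF assms])
  also have "\<dots> = enn2real (\<integral>\<^sup>+s. ennreal ((real_of_int (fst s))\<^sup>2) \<partial>trw_law p t)"
    by (rule integral_eq_nn_integral) auto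
  also have "\<dots> = (\<Sum>s<t. pmf (trap_law p s) 0)"
    by (simp only: nn_integral_trw_law_square) (simp add: sum_nonneg)
  finally show ?thesis .
qed

text \<open>Passing from \<open>t\<close> to \<open>Suc t\<close> adds \<open>u (Suc t)\<close> on
  the left. On the right each old term gains \<open>q \<tau> * u (t - \<tau>)\<close> and the new
  term \<open>\<tau> = Suc t\<close>, whose inner sum is empty, contributes
  \<open>q (Suc t)\<close>. The renewal equation says that these increments agree.\<close>

lemma renewal_partial_sums:
  fixes u q :: "nat \<Rightarrow> real"
  assumes "\<And>t. u t = q t + (\<Sum>s<t. u s * q (t - Suc s))"
  shows "(\<Sum>s<Suc t. u s) = (\<Sum>\<tau>\<le>t. q \<tau> * ((\<Sum>s<t - \<tau>. u s) + 1))"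
proof (induction t)
  case 0
  show ?case by (simp add: assms[of 0])
next
  case (Suc t)
  \<comment> \<open>The convolution is reversed by \<open>\<tau> = t - s\<close>.\<close>
  have "(\<Sum>s<Suc t. u s * q (Suc t - Suc s)) = (\<Sum>\<tau>\<le>t. q \<tau> * u (t - \<tau>))"
    unfolding lessThan_Suc_atMost
    by (rule sum.reindex_bij_witness[of _ "\<lambda>s. t - s" "\<lambda>s. t - s"]) auto
  then have "(\<Sum>s<Suc (Suc t). u s)
      = (\<Sum>\<tau>\<le>t. q \<tau> * ((\<Sum>s<t - \<tau>. u s) + 1)) + (\<Sum>\<tau>\<le>t. q \<tau> * u (t - \<tau>)) + q (Suc t)"
    using Suc.IH assms[of "Suc t"] by simp
  also have "\<dots> = (\<Sum>\<tau>\<le>t. q \<tau> * ((\<Sum>s<Suc t - \<tau>. u s) + 1)) + q (Suc t)"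
    by (simp add: Suc_diff_le algebra_simps flip: sum.distrib)
  finally show ?case by simp
qed

theorem proposition1:
  fixes M :: "'a measure" and p :: "nat pmf"
    and X :: "nat \<Rightarrow> 'a \<Rightarrow> int" and T :: "nat \<Rightarrow> 'a \<Rightarrow> nat" and t :: nat
  assumes "trapped_random_walk M p X T"
    and "started_at_origin M p X T"
  shows "msd M X (t + 1) = (\<Sum>\<tau>\<in>{0..t}. pmf p \<tau> * (msd M X (t - \<tau>) + 1))"
proof -
  have "pmf (trap_law p t) 0 = pmf p t + (\<Sum>s<t. pmf (trap_law p s) 0 * pmf p (t - Suc s))" for t
    using trap_law_eq[of p t 0] by simp
  \<comment> \<open>By \<open>msd_eq\<close>, the partial sums of \<open>u\<close> are exactly the
    mean squared displacements.\<close>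
  from renewal_partial_sums[OF this] show ?thesis
    by (simp only: msd_eq[OF assms] atMost_atLeast0 Suc_eq_plus1)
qed

end
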